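(* Let $A,B,C_1,\dots,C_m\in\mathbb{C}^{n\times n}$, $r_i,s_i\in\mathbb{C}^n$ and $g_i\in\mathbb{C}^n\setminus\{0\}$ for $i=1,\dots,m$, and put $f_i(x)=\frac{r_i^Tx}{s_i^Tx}$. If $(\lambda,x)$ is a solution of the NEPv $$(A+\lambda B+f_1(x)C_1+\cdots+f_m(x)C_m)x=0,$$ then $$(\lambda,\mu_1,\dots,\mu_m,x_1,\dots,x_{m+1})=(\lambda,f_1(x),\dots,f_m(x),x,\dots,x)$$ is a solution of the multiparameter eigenvalue problem $$\begin{aligned}-Ax_1&=(\lambda B+\mu_1C_1+\cdots+\mu_mC_m)x_1,\\ -(A+g_jr_j^T)x_{j+1}&=\bigl(\lambda B+\mu_1C_1+\cdots+\mu_mC_m-\mu_jg_js_j^T\bigr)x_{j+1},\qquad j=1,\dots,m.\end{aligned}$$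
   Context: A solution of the NEPv is a pair $(\lambda,x)$ with $\lambda\in\mathbb{C}$, $x\in\mathbb{C}^n\setminus\{0\}$ and $s_i^Tx\ne0$ for all $i$ satisfying the NEPv equation. A solution of the multiparameter eigenvalue problem is a tuple $(\lambda,\mu_1,\dots,\mu_m,x_1,\dots,x_{m+1})$ with $\lambda,\mu_i\in\mathbb{C}$ and all $x_i\in\mathbb{C}^n$ nonzero that satisfies all $m+1$ equations. The superscript $T$ denotes transpose without conjugation. *)

theory Defs
  imports "HOL-Analysis.Analysis"
begin

(* The library product "*s" scales vectors only, and "*\<^sub>R" has real scalars. *)
definition mat_scale :: "complex \<Rightarrow> complex^'n^'n \<Rightarrow> complex^'n^'n" (infixr "*\<^sub>M" 75)
  where "c *\<^sub>M M = (\<chi> k l. c * M $ k $ l)"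

definition outer_prod :: "complex^'n \<Rightarrow> complex^'n \<Rightarrow> complex^'n^'n"
  where "outer_prod u v = (\<chi> k l. u $ k * v $ l)"

(* The bilinear scalar_product (no conjugation) renders r\<^sup>T x; the inner product of the
   library on complex^'n is real-valued and would be wrong here. *)
definition rquot :: "complex^'n \<Rightarrow> complex^'n \<Rightarrow> complex^'n \<Rightarrow> complex"
  where "rquot r s x = scalar_product r x / scalar_product s x"

(* Families indexed by 1, ..., m are functions on nat of which only the values at 1, ..., m
   (for the vectors of the multiparameter problem: at 1, ..., m+1) are used. *)
definition nepv_solution ::
  "nat \<Rightarrow> complex^'n^'n \<Rightarrow> complex^'n^'n \<Rightarrow> (nat \<Rightarrow> complex^'n^'n) \<Rightarrow>
   (nat \<Rightarrow> complex^'n) \<Rightarrow> (nat \<Rightarrow> complex^'n) \<Rightarrow> complex \<Rightarrow> complex^'n \<Rightarrow> bool"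
  where "nepv_solution m A B C r s lam x \<longleftrightarrow>
    x \<noteq> 0 \<and> (\<forall>i\<in>{1..m}. scalar_product (s i) x \<noteq> 0) \<and>
    (A + lam *\<^sub>M B + (\<Sum>i=1..m. rquot (r i) (s i) x *\<^sub>M C i)) *v x = 0"

definition mep_solution ::
  "nat \<Rightarrow> complex^'n^'n \<Rightarrow> complex^'n^'n \<Rightarrow> (nat \<Rightarrow> complex^'n^'n) \<Rightarrow>
   (nat \<Rightarrow> complex^'n) \<Rightarrow> (nat \<Rightarrow> complex^'n) \<Rightarrow> (nat \<Rightarrow> complex^'n) \<Rightarrow>
   complex \<Rightarrow> (nat \<Rightarrow> complex) \<Rightarrow> (nat \<Rightarrow> complex^'n) \<Rightarrow> bool"
  where "mep_solution m A B C r s g lam mu X \<longleftrightarrow>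
    (\<forall>i\<in>{1..m+1}. X i \<noteq> 0) \<and>
    (- A) *v X 1 = (lam *\<^sub>M B + (\<Sum>i=1..m. mu i *\<^sub>M C i)) *v X 1 \<and>
    (\<forall>j\<in>{1..m}.
      (- (A + outer_prod (g j) (r j))) *v X (j+1) =
      (lam *\<^sub>M B + (\<Sum>i=1..m. mu i *\<^sub>M C i) - mu j *\<^sub>M outer_prod (g j) (s j)) *v X (j+1))"

end

theory Submission
  imports Defs
begin

text \<open>
  Applied to \<open>x\<close>, the rank-one matrix \<open>g r\<^sup>T\<close> gives \<open>(r\<^sup>T x) g\<close>. The equation
  \<open>(r\<^sup>T x) g = \<mu> (s\<^sup>T x) g\<close> holds for \<open>\<mu> = r\<^sup>T x / s\<^sup>T x\<close>, which is the value taken by the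
  quotient at \<open>x\<close>. So at a solution \<open>x\<close> of the nonlinear problem the terms \<open>g\<^sub>j r\<^sub>j\<^sup>T\<close> on the
  left and \<open>\<mu>\<^sub>j g\<^sub>j s\<^sub>j\<^sup>T\<close> on the right of equation \<open>j + 1\<close> act in the same way on \<open>x\<close>
  (lemma \<open>rank_one_terms_agree\<close>), and each of the \<open>m + 1\<close> equations reduces to the nonlinear
  one with \<open>A x\<close> moved to the other side.
\<close>

lemma outer_prod_vec: "outer_prod u v *v x = scalar_product v x *s u"
  by (simp add: vec_eq_iff outer_prod_def matrix_vector_mult_def scalar_product_def
      sum_distrib_left mult_ac)

lemma mat_scale_vec: "(c *\<^sub>M M) *v x = c *s (M *v x)"
  by (simp add: vec_eq_iff mat_scale_def matrix_vector_mult_def sum_distrib_left mult_ac)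

lemma uminus_matrix_vec: "(- M) *v x = - (M *v x)"
  for M :: "complex^'n^'m"
  by (simp add: vec_eq_iff matrix_vector_mult_def sum_negf)

text \<open>The quotient is the factor by which \<open>s\<^sup>T x\<close> has to be scaled to become \<open>r\<^sup>T x\<close>. For
  \<open>s\<^sup>T x = 0\<close> it would be \<open>0\<close>, and the identity would fail whenever \<open>(r\<^sup>T x) g\<close> is nonzero.\<close>
lemma rank_one_terms_agree:
  assumes "scalar_product s x \<noteq> 0"
  shows "outer_prod g r *v x = (rquot r s x *\<^sub>M outer_prod g s) *v x"
  using assms by (simp add: mat_scale_vec outer_prod_vec rquot_def)

theorem theorem3p2:
  fixes A B :: "complex^'n^'n" and C :: "nat \<Rightarrow> complex^'n^'n"
    and r s g :: "nat \<Rightarrow> complex^'n" and m :: nat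
    and lam :: complex and x :: "complex^'n"
  assumes "\<And>i. i \<in> {1..m} \<Longrightarrow> g i \<noteq> 0"
    and "nepv_solution m A B C r s lam x"
  shows "mep_solution m A B C r s g lam (\<lambda>i. rquot (r i) (s i) x) (\<lambda>i. x)"
proof -
  define N where "N = lam *\<^sub>M B + (\<Sum>i=1..m. rquot (r i) (s i) x *\<^sub>M C i)"
  have x: "x \<noteq> 0" and s: "\<And>i. i \<in> {1..m} \<Longrightarrow> scalar_product (s i) x \<noteq> 0"
    and "(A + N) *v x = 0"
    using assms(2) by (auto simp: nepv_solution_def N_def add.assoc)
  then have N: "(- A) *v x = N *v x"
    by (simp add: uminus_matrix_vec matrix_vector_mult_add_rdistrib neg_eq_iff_add_eq_0)
  have "(- (A + outer_prod (g j) (r j))) *v x =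
      (N - rquot (r j) (s j) x *\<^sub>M outer_prod (g j) (s j)) *v x" if "j \<in> {1..m}" for j
  proof -
    have "(- (A + outer_prod (g j) (r j))) *v x = (- A) *v x - outer_prod (g j) (r j) *v x"
      by (simp only: uminus_matrix_vec matrix_vector_mult_add_rdistrib minus_add_distrib
          diff_conv_add_uminus)
    also have "\<dots> = N *v x - (rquot (r j) (s j) x *\<^sub>M outer_prod (g j) (s j)) *v x"
      by (simp only: N rank_one_terms_agree[OF s[OF that]])
    finally show ?thesis
      by (simp add: matrix_vector_mult_diff_rdistrib)
  qed
  with x N show ?thesis
    by (simp add: mep_solution_def N_def)
qed

end
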